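(* Let $\beta\in[0,1]$, $p\in[-2,2]$, let $N\ge1$ and $n\ge 2$ be integers, and put $\sigma=(n-(n-1)\beta)^N$ and $\mu=(n+1-n\beta)^N$. If $f\in\mathcal{A}_\beta(p)$ has the form $f(z)=z+\sum_{k=2}^\infty a_kz^k$, then $$|a_{n+1}^N-a_n^N|\le\begin{cases}\dfrac{2(\sigma^n-\mu^n)(2^{N-1}\sigma^2+2^{N-1}\mu^2-\sigma\mu p^N)}{(\sigma-\mu)\sigma\mu^{n+1}}+\dfrac{\sigma^n|2^N\mu-\sigma p^N|}{\sigma\mu^{n+1}}, & \beta\in[0,1),\\[3mm] \dfrac{2^N\sqrt{2-2^{1-N}p^N}}{\sigma}, & \beta=1.\end{cases}$$ The bound for $\beta\in[0,1)$ is sharp for $p=2$, whereas for $\beta=1$ the bound is sharp for odd $N$ and $p=-2$.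
   Context: $\mathbb{D}=\{z\in\mathbb{C}:|z|<1\}$. $\mathcal{A}$ is the class of holomorphic functions $f$ on $\mathbb{D}$ of the form $f(z)=z+\sum_{n=2}^\infty a_n z^n$. For $\beta\in[0,1]$, $\mathcal{A}_\beta=\{f\in\mathcal{A}:\operatorname{Re}(\beta \frac{f(z)}{z}+(1-\beta)f'(z))>0 \text{ for all } z\in\mathbb{D}\}$, where $f(z)/z$ takes the value $1$ at $z=0$. For $p\in[-2,2]$, $\mathcal{A}_\beta(p)=\{f\in\mathcal{A}_\beta:(2-\beta)a_2=p\}$, where $a_2=f''(0)/2$. A bound being sharp means that equality is attained for some $f\in\mathcal{A}_\beta(p)$. *)

theory Defs
  imports "HOL-Complex_Analysis.Complex_Analysis"
begin

definition normalized_series :: "(complex \<Rightarrow> complex) \<Rightarrow> (nat \<Rightarrow> complex) \<Rightarrow> bool" where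
  "normalized_series f a \<longleftrightarrow>
     (\<forall>z \<in> ball 0 1. (\<lambda>k. a (k + 2) * z ^ (k + 2)) sums (f z - z))"

definition class_A :: "(complex \<Rightarrow> complex) set" where
  "class_A = {f. f holomorphic_on ball 0 1 \<and> (\<exists>a. normalized_series f a)}"

text \<open>The function \<open>f(z)/z\<close> with its removable singularity filled in; the value \<open>1\<close> at \<open>0\<close>
  is the limit only for normalized \<open>f\<close>.\<close>

definition quot_z :: "(complex \<Rightarrow> complex) \<Rightarrow> complex \<Rightarrow> complex" where
  "quot_z f z = (if z = 0 then 1 else f z / z)"

definition class_A_beta :: "real \<Rightarrow> (complex \<Rightarrow> complex) set" where
  "class_A_beta \<beta> = {f \<in> class_A. \<forall>z \<in> ball 0 1.
     Re (of_real \<beta> * quot_z f z + of_real (1 - \<beta>) * deriv f z) > 0}"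

definition class_A_beta_p :: "real \<Rightarrow> real \<Rightarrow> (complex \<Rightarrow> complex) set" where
  "class_A_beta_p \<beta> p = {f \<in> class_A_beta \<beta>.
     of_real (2 - \<beta>) * ((deriv ^^ 2) f 0 / 2) = of_real p}"

end

theory Submission
  imports Defs
begin

text \<open>
  Put \<open>g z = \<beta> f(z)/z + (1 - \<beta>) f'(z) = 1 + \<Sum> c\<^sub>k z\<^sup>k\<close>. Then \<open>Re g > 0\<close>, \<open>c\<^sub>1 = p\<close> and
  \<open>a (k + 1) = c\<^sub>k / (1 + (1 - \<beta>) k)\<close>. By Herglotz's theorem \<open>c\<^sub>k / 2\<close> is the integral of
  \<open>z\<^sup>k\<close> against a probability measure on the unit circle. The \<open>N\<close>-fold multiplicative convolution of
  this measure has the moments \<open>e\<^sub>k = (c\<^sub>k / 2)\<^sup>N\<close>, so that \<open>e\<^sub>1 = q = (p / 2)\<^sup>N\<close> is real and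
  \<open>a (n + 1)\<^sup>N - a n\<^sup>N = (2\<^sup>N / \<sigma>) (r e (n) - e (n - 1))\<close> with \<open>r = \<sigma> / \<mu>\<close>. Everything thus
  reduces to an estimate for the moments of a probability measure whose first moment is \<open>q\<close>.

  In place of measures the proof uses positive definite sequences. Lemma
  \<open>positive_definite_half_coeffs_power\<close> shows that \<open>e\<close> is one: on each circle of radius \<open>\<rho> < 1\<close>
  the nonnegative density \<open>Re g\<close> has the Fourier coefficients \<open>c\<^sub>k / 2\<close>, damped by powers of
  \<open>\<rho>\<close>, and multiplication by such coefficients preserves positive definiteness.

  If \<open>\<beta> < 1\<close>, then \<open>r < 1\<close>. On the unit circle, with \<open>w\<close> the conjugate of \<open>z\<close>,
  \<open>1 - r z = \<bar>1 - r z\<bar>\<^sup>2 / (1 - r w)\<close>. Expanding the fraction as a geometric series in \<open>r w\<close>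
  up to order \<open>n\<close> and integrating against \<open>z ^ (n - 1)\<close>, one has \<open>n\<close> terms each at most
  \<open>r ^ j (1 + r\<^sup>2 - 2 r q)\<close> in modulus, and a remainder of modulus \<open>r ^ n \<bar>q - r\<bar>\<close>, which is at
  most \<open>r ^ n (1 - r q)\<close> (lemma \<open>positive_definite_consecutive_bound\<close>). The sum is exactly the stated
  bound (lemma \<open>bound_in_ratio_form\<close>).

  If \<open>\<beta> = 1\<close>, then \<open>\<sigma> = \<mu> = 1\<close> and Cauchy-Schwarz bounds the integral of
  \<open>z ^ (n - 1) (z - 1)\<close> by the square root of the integral of \<open>\<bar>z - 1\<bar>\<^sup>2\<close>, which is \<open>2 - 2 q\<close>
  (lemma \<open>positive_definite_diff_norm_sq_le\<close>).

  Equality is attained by the point mass at \<open>1\<close> for \<open>p = 2\<close> and at \<open>- 1\<close> for \<open>p = - 2\<close>, that is,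
  by \<open>c\<^sub>k = 2 \<epsilon>\<^sup>k\<close> with \<open>\<epsilon> = p / 2\<close>.
\<close>

section \<open>Power series on the unit disc\<close>

lemma power_series_deriv_sums:
  fixes h :: "complex \<Rightarrow> complex"
  assumes "\<And>z. norm z < 1 \<Longrightarrow> (\<lambda>n. c n * z ^ n) sums h z" and "norm z < 1"
  shows "(\<lambda>n. diffs c n * z ^ n) sums deriv h z"
proof -
  have "h holomorphic_on ball 0 1"
    by (rule power_series_holomorphic[where a = c]) (use assms(1) in auto)
  then have "(h has_field_derivative deriv h z) (at z)"
    by (rule holomorphic_derivI) (use assms(2) in auto)
  then show ?thesis
    using assms by (intro termdiffs_sums_strong[where f = h and K = 1])
qed

lemma power_series_higher_deriv_0:
  fixes h :: "complex \<Rightarrow> complex"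
  assumes "\<And>z. norm z < 1 \<Longrightarrow> (\<lambda>n. c n * z ^ n) sums h z"
  shows "(deriv ^^ k) h 0 = fact k * c k"
proof -
  have "(\<lambda>n. (diffs ^^ k) c n * z ^ n) sums (deriv ^^ k) h z" if "norm z < 1" for z
    using that
  proof (induction k arbitrary: z)
    case (Suc k)
    then show ?case
      using power_series_deriv_sums[of "(diffs ^^ k) c" "(deriv ^^ k) h" z] by simp
  qed (use assms in auto)
  from this[of 0] have "(deriv ^^ k) h 0 = (diffs ^^ k) c 0"
    using powser_sums_zero_iff by force
  also have "(diffs ^^ k) c n = fact (n + k) / fact n * c (n + k)" for n
  proof (induction k arbitrary: n)
    case (Suc k)
    show ?case
      using Suc.IH[of "Suc n"] by (simp add: diffs_def divide_simps mult_ac del: of_nat_Suc)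
  qed simp
  finally show ?thesis by simp
qed

section \<open>Positive definite sequences from functions with positive real part\<close>

text \<open>This is the usual condition that the function \<open>e\<close> on the group of integers has positive
  semidefinite matrices \<open>(e (s\<^sub>i - s\<^sub>j))\<close>. The points \<open>s\<^sub>i\<close> form an arbitrary family, so
  they may coincide; this lets test vectors be written down without checking that the points at which
  they live are distinct.\<close>
definition positive_definite :: "(int \<Rightarrow> complex) \<Rightarrow> bool" where
  "positive_definite e \<longleftrightarrow> (\<forall>k. e (- k) = cnj (e k)) \<and>
     (\<forall>(m::nat) s x. 0 \<le> Re (\<Sum>i<m. \<Sum>j<m. x i * cnj (x j) * e (s i - s j)))"

text \<open>For \<open>g = 1 + \<Sum> c\<^sub>k z\<^sup>k\<close> with positive real part these are the Fourier coefficients of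
  the Herglotz probability measure of \<open>g\<close>.\<close>
definition half_coeffs :: "(nat \<Rightarrow> complex) \<Rightarrow> int \<Rightarrow> complex" where
  "half_coeffs c k = (if k = 0 then 1 else if k > 0 then c (nat k) / 2 else cnj (c (nat (- k))) / 2)"

text \<open>The factor \<open>\<rho> cis (2 \<pi> t)\<close> is what remains of the derivative of the path after division by
  \<open>2 \<pi> \<i>\<close>.\<close>
lemma has_integral_circlepath_cis:
  assumes "(f has_contour_integral I) (circlepath 0 \<rho>)"
  shows "((\<lambda>t. f (of_real \<rho> * cis (2 * pi * t)) * (of_real \<rho> * cis (2 * pi * t)))
            has_integral I / (2 * pi * \<i>)) {0..1}"
proof -
  have "((\<lambda>t. f (circlepath 0 \<rho> t) * vector_derivative (circlepath 0 \<rho>) (at t within {0..1}))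
      has_integral I) {0..1}"
    using assms by (simp add: has_contour_integral_def)
  from has_integral_mult_right[OF this, of "1 / (2 * pi * \<i>)"]
  have "((\<lambda>t. 1 / (2 * pi * \<i>) * (f (circlepath 0 \<rho> t) * vector_derivative (circlepath 0 \<rho>) (at t within {0..1})))
      has_integral I / (2 * pi * \<i>)) {0..1}"
    by simp
  then show ?thesis
  proof (rule has_integral_eq[rotated])
    fix t :: real
    assume "t \<in> {0..1}"
    moreover have E: "exp (2 * of_real pi * \<i> * of_real t) = cis (2 * pi * t)"
      by (simp add: cis_conv_exp mult_ac)
    moreover have "circlepath 0 \<rho> t = of_real \<rho> * cis (2 * pi * t)"
      using E by (simp add: circlepath)
    ultimately show "1 / (2 * pi * \<i>) * (f (circlepath 0 \<rho> t) * vector_derivative (circlepath 0 \<rho>) (at t within {0..1}))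
        = f (of_real \<rho> * cis (2 * pi * t)) * (of_real \<rho> * cis (2 * pi * t))"
      by (simp add: vector_derivative_circlepath01 field_simps)
  qed
qed

text \<open>Cauchy's formula for the derivatives of \<open>g\<close> computes the Fourier coefficients with nonnegative index
  of \<open>g\<close> on the circle of radius \<open>\<rho>\<close>.\<close>
lemma circle_fourier_nonneg:
  assumes hol: "g holomorphic_on ball 0 1" and \<rho>: "0 < \<rho>" "\<rho> < 1"
  shows "((\<lambda>t. g (of_real \<rho> * cis (2 * pi * t)) * cis (- (2 * pi * real k * t))) has_integral
            (deriv ^^ k) g 0 / fact k * of_real (\<rho> ^ k)) {0..1}"
proof -
  have "((\<lambda>u. g u / (u - 0) ^ Suc k) has_contour_integral
          (2 * pi * \<i>) / fact k * (deriv ^^ k) g 0) (circlepath 0 \<rho>)"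
    using \<rho> by (intro Cauchy_has_contour_integral_higher_derivative_circlepath
        holomorphic_on_imp_continuous_on holomorphic_on_subset[OF hol]) auto
  from has_integral_mult_right[OF has_integral_circlepath_cis[OF this], of "of_real (\<rho> ^ k)"]
  have "((\<lambda>t. of_real (\<rho> ^ k) * (g (of_real \<rho> * cis (2 * pi * t)) / (of_real \<rho> * cis (2 * pi * t)) ^ Suc k
          * (of_real \<rho> * cis (2 * pi * t)))) has_integral
          (deriv ^^ k) g 0 / fact k * of_real (\<rho> ^ k)) {0..1}"
    by (simp add: mult_ac)
  then show ?thesis
  proof (rule has_integral_eq[rotated])
    fix t :: real
    have "cis (- (2 * pi * real k * t)) = inverse (cis (2 * pi * t)) ^ k"
      by (simp add: Complex.DeMoivre mult_ac)
    then show "of_real (\<rho> ^ k) * (g (of_real \<rho> * cis (2 * pi * t)) / (of_real \<rho> * cis (2 * pi * t)) ^ Suc k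
          * (of_real \<rho> * cis (2 * pi * t))) =
      g (of_real \<rho> * cis (2 * pi * t)) * cis (- (2 * pi * real k * t))"
      using \<rho> by (simp add: power_mult_distrib power_inverse field_simps del: cis_inverse)
  qed
qed

text \<open>The coefficients with negative index vanish, because \<open>g u * u ^ l\<close> is holomorphic and Cauchy's
  theorem applies.\<close>
lemma circle_fourier_negative:
  assumes hol: "g holomorphic_on ball 0 1" and \<rho>: "0 < \<rho>" "\<rho> < 1"
  shows "((\<lambda>t. g (of_real \<rho> * cis (2 * pi * t)) * cis (2 * pi * real (Suc l) * t)) has_integral 0) {0..1}"
proof -
  have "((\<lambda>u. g u * u ^ l) has_contour_integral 0) (circlepath 0 \<rho>)"
    using \<rho> by (intro Cauchy_theorem_disc_simple[of _ 0 1] holomorphic_intros hol) auto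
  from has_integral_mult_right[OF has_integral_circlepath_cis[OF this], of "1 / of_real (\<rho> ^ Suc l)"]
  have "((\<lambda>t. 1 / of_real (\<rho> ^ Suc l) * (g (of_real \<rho> * cis (2 * pi * t)) * (of_real \<rho> * cis (2 * pi * t)) ^ l
          * (of_real \<rho> * cis (2 * pi * t)))) has_integral 0) {0..1}"
    by simp
  then show ?thesis
  proof (rule has_integral_eq[rotated])
    fix t :: real
    have "cis (2 * pi * real (Suc l) * t) = cis (2 * pi * t) ^ Suc l"
      unfolding Complex.DeMoivre by (simp add: mult_ac)
    then show "1 / of_real (\<rho> ^ Suc l) * (g (of_real \<rho> * cis (2 * pi * t)) * (of_real \<rho> * cis (2 * pi * t)) ^ l
          * (of_real \<rho> * cis (2 * pi * t))) =
      g (of_real \<rho> * cis (2 * pi * t)) * cis (2 * pi * real (Suc l) * t)"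
      using \<rho> by (simp add: power_mult_distrib)
  qed
qed

text \<open>Averaging the coefficients of \<open>g\<close> and of its conjugate gives those of the real part. This
  replaces Herglotz's theorem: instead of a limit measure on the unit circle, the density
  \<open>Re g\<close> on the circle of radius \<open>\<rho>\<close> represents the damped sequence \<open>half_coeffs c k * \<rho> ^ nat \<bar>k\<bar>\<close>.\<close>
lemma circle_fourier_Re:
  assumes hol: "g holomorphic_on ball 0 1" and g0: "g 0 = 1"
    and \<rho>: "0 < \<rho>" "\<rho> < 1"
  defines "c \<equiv> \<lambda>k. (deriv ^^ k) g 0 / fact k"
  shows "((\<lambda>t. of_real (Re (g (of_real \<rho> * cis (2 * pi * t)))) * cis (- (2 * pi * of_int k * t)))
            has_integral half_coeffs c k * of_real (\<rho> ^ nat \<bar>k\<bar>)) {0..1}"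
proof -
  define G where "G t = g (of_real \<rho> * cis (2 * pi * t))" for t
  define A where "A k = (if k \<ge> 0 then c (nat k) * of_real (\<rho> ^ nat k) else 0)" for k :: int
  have A: "((\<lambda>t. G t * cis (- (2 * pi * of_int k * t))) has_integral A k) {0..1}" for k
  proof (cases "k \<ge> 0")
    case True
    then show ?thesis
      using circle_fourier_nonneg[OF hol \<rho>, of "nat k"] by (simp add: A_def G_def c_def)
  next
    case False
    then show ?thesis
      using circle_fourier_negative[OF hol \<rho>, of "nat (-k) - 1"] by (simp add: A_def G_def)
  qed
  have B: "((\<lambda>t. cnj (G t * cis (2 * pi * of_int k * t))) has_integral cnj (A (-k))) {0..1}"
    using A[of "-k"] has_integral_cnj[of "\<lambda>t. G t * cis (2 * pi * of_int k * t)" "A (-k)" "{0..1}"]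
    by (simp add: o_def)
  have "((\<lambda>t. 1 / 2 * (G t * cis (- (2 * pi * of_int k * t)) + cnj (G t * cis (2 * pi * of_int k * t))))
      has_integral 1 / 2 * (A k + cnj (A (-k)))) {0..1}"
    by (intro has_integral_mult_right has_integral_add A B)
  moreover have "1 / 2 * (A k + cnj (A (-k))) = half_coeffs c k * of_real (\<rho> ^ nat \<bar>k\<bar>)"
    using g0 by (cases "k = 0"; cases "k > 0") (simp_all add: A_def half_coeffs_def c_def)
  moreover have "1 / 2 * (G t * cis (- (2 * pi * of_int k * t)) + cnj (G t * cis (2 * pi * of_int k * t)))
      = of_real (Re (G t)) * cis (- (2 * pi * of_int k * t))" for t
  proof -
    define C where "C = cis (- (2 * pi * of_int k * t))"
    have C: "cnj (cis (2 * pi * of_int k * t)) = C"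
      by (simp add: cis_cnj C_def)
    have "1 / 2 * (G t * C + cnj (G t * cis (2 * pi * of_int k * t))) = (G t + cnj (G t)) / 2 * C"
      unfolding complex_cnj_mult C by (simp add: ring_distribs add_divide_distrib)
    also have "G t + cnj (G t) = of_real (2 * Re (G t))"
      by (rule complex_add_cnj)
    finally show ?thesis
      unfolding C_def by simp
  qed
  ultimately show ?thesis
    unfolding G_def by simp
qed

lemma half_coeffs_uminus: "half_coeffs c (- k) = cnj (half_coeffs c k)"
  by (auto simp: half_coeffs_def)

text \<open>This is the case of Schur's product theorem in which one factor comes from a function with positive
  real part. After damping by \<open>\<rho> ^ nat \<bar>k\<bar>\<close> that factor is an average of characters
  \<open>cis (- 2 \<pi> k t)\<close> with nonnegative weight, and multiplying a positive definite sequence by a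
  character only multiplies the entries of the test vectors by unimodular numbers. The damping disappears as
  \<open>\<rho> \<rightarrow> 1\<close>.\<close>
lemma positive_definite_mult_half_coeffs:
  assumes hol: "g holomorphic_on ball 0 1" and g0: "g 0 = 1"
    and pos: "\<And>z. z \<in> ball 0 1 \<Longrightarrow> Re (g z) > 0"
    and e: "positive_definite e"
  defines "h \<equiv> half_coeffs (\<lambda>k. (deriv ^^ k) g 0 / fact k)"
  shows "positive_definite (\<lambda>k. e k * h k)"
  unfolding positive_definite_def
proof (intro conjI allI)
  show "e (- k) * h (- k) = cnj (e k * h k)" for k
    using e by (simp add: positive_definite_def h_def half_coeffs_uminus)
next
  fix m :: nat and s :: "nat \<Rightarrow> int" and x :: "nat \<Rightarrow> complex"
  define d where "d i j = s i - s j" for i j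
  define S where "S \<rho> = (\<Sum>i<m. \<Sum>j<m. x i * cnj (x j) * e (d i j) * (h (d i j) * of_real (\<rho> ^ nat \<bar>d i j\<bar>)))" for \<rho> :: real
  have nonneg: "0 \<le> Re (S \<rho>)" if \<rho>: "0 < \<rho>" "\<rho> < 1" for \<rho>
  proof -
    define w where "w t = Re (g (of_real \<rho> * cis (2 * pi * t)))" for t
    define y where "y t i = x i * cis (- (2 * pi * of_int (s i) * t))" for t i
    have "((\<lambda>t. \<Sum>i<m. \<Sum>j<m. x i * cnj (x j) * e (d i j) *
            (of_real (w t) * cis (- (2 * pi * of_int (d i j) * t)))) has_integral S \<rho>) {0..1}"
      unfolding S_def h_def w_def
      by (intro has_integral_sum finite_lessThan has_integral_mult_right circle_fourier_Re hol g0 \<rho>)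
    then have int: "((\<lambda>t. Re (\<Sum>i<m. \<Sum>j<m. x i * cnj (x j) * e (d i j) *
            (of_real (w t) * cis (- (2 * pi * of_int (d i j) * t))))) has_integral Re (S \<rho>)) {0..1}"
      by (rule has_integral_Re)
    show ?thesis
    proof (rule has_integral_nonneg[OF int])
      fix t :: real
      have "cis (- (2 * pi * of_int (d i j) * t)) =
          cis (- (2 * pi * of_int (s i) * t)) * cnj (cis (- (2 * pi * of_int (s j) * t)))" for i j
        unfolding cis_cnj cis_mult d_def by (simp add: algebra_simps)
      then have "x i * cnj (x j) * e (d i j) * (of_real (w t) * cis (- (2 * pi * of_int (d i j) * t)))
          = of_real (w t) * (y t i * cnj (y t j) * e (d i j))" for i j
        by (simp only: y_def complex_cnj_mult mult_ac)
      then have "(\<Sum>i<m. \<Sum>j<m. x i * cnj (x j) * e (d i j) *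
            (of_real (w t) * cis (- (2 * pi * of_int (d i j) * t))))
          = of_real (w t) * (\<Sum>i<m. \<Sum>j<m. y t i * cnj (y t j) * e (d i j))"
        by (simp only: sum_distrib_left)
      moreover have "0 \<le> w t"
        using pos[of "of_real \<rho> * cis (2 * pi * t)"] \<rho> by (simp add: w_def norm_mult less_imp_le)
      moreover have "0 \<le> Re (\<Sum>i<m. \<Sum>j<m. y t i * cnj (y t j) * e (d i j))"
        using e unfolding positive_definite_def d_def by blast
      ultimately show "0 \<le> Re (\<Sum>i<m. \<Sum>j<m. x i * cnj (x j) * e (d i j) *
            (of_real (w t) * cis (- (2 * pi * of_int (d i j) * t))))"
        by simp
    qed
  qed
  have "((\<lambda>\<rho>. Re (S \<rho>)) \<longlongrightarrow> Re (S 1)) (at_left 1)"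
    unfolding S_def by (intro tendsto_intros)
  moreover have "eventually (\<lambda>\<rho>. 0 \<le> Re (S \<rho>)) (at_left 1)"
    using nonneg by (auto simp: eventually_at_left[of 0 1] intro!: exI[of _ 0])
  ultimately have "0 \<le> Re (S 1)"
    by (rule tendsto_lowerbound) simp
  then show "0 \<le> Re (\<Sum>i<m. \<Sum>j<m. x i * cnj (x j) * (e (s i - s j) * h (s i - s j)))"
    by (simp add: S_def d_def mult_ac)
qed

lemma positive_definite_1: "positive_definite (\<lambda>_. 1)"
proof -
  have "0 \<le> Re (\<Sum>i<m. \<Sum>j<m. x i * cnj (x j) * 1)" for m :: nat and x
  proof -
    have "(\<Sum>i<m. \<Sum>j<m. x i * cnj (x j) * 1) = (\<Sum>i<m. x i) * cnj (\<Sum>j<m. x j)"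
      by (simp add: sum_product)
    also have "\<dots> = of_real ((cmod (\<Sum>i<m. x i))\<^sup>2)"
      by (simp only: complex_norm_square cnj_sum)
    finally show ?thesis
      by (simp only: Re_complex_of_real) simp
  qed
  then show ?thesis
    by (simp add: positive_definite_def)
qed

text \<open>Powers of the coefficients are therefore again Fourier coefficients of a probability measure, so an
  estimate for \<open>N\<close>-th powers is no harder than the estimate for \<open>N = 1\<close>.\<close>
lemma positive_definite_half_coeffs_power:
  assumes "g holomorphic_on ball 0 1" and "g 0 = 1"
    and "\<And>z. z \<in> ball 0 1 \<Longrightarrow> Re (g z) > 0"
  shows "positive_definite (\<lambda>k. half_coeffs (\<lambda>k. (deriv ^^ k) g 0 / fact k) k ^ N)"
proof (induction N)
  case (Suc N)
  from positive_definite_mult_half_coeffs[OF assms this] show ?case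
    by (simp add: mult.commute)
qed (simp add: positive_definite_1)

section \<open>Inequalities for positive definite sequences\<close>

lemma unimodular_direction: obtains l :: complex where "l * cnj l = 1" "cnj l * z = - of_real (cmod z)"
proof (cases "z = 0")
  case False
  have "sgn z * cnj (sgn z) = 1"
    using False complex_norm_square[of "sgn z"] by (simp add: norm_sgn)
  moreover have "cnj (sgn z) * z = of_real (cmod z)"
    using False complex_norm_square[of z]
    by (simp add: sgn_div_norm scaleR_conv_of_real field_simps power2_eq_square)
  ultimately show ?thesis
    by (intro that[of "- sgn z"]) auto
qed (use that[of 1] in auto)

text \<open>Test the form on two points, with the unimodular weight that turns the cross terms into
  \<open>- cmod (e k)\<close>.\<close>
lemma positive_definite_norm_le:
  assumes e: "positive_definite e"
  shows "cmod (e k) \<le> Re (e 0)"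
proof -
  obtain l where l: "l * cnj l = 1" "cnj l * e k = - of_real (cmod (e k))"
    by (rule unimodular_direction)
  have herm: "e (- k) = cnj (e k)"
    using e by (simp add: positive_definite_def)
  have "l * cnj (e k) = cnj (cnj l * e k)" by simp
  also have "\<dots> = - of_real (cmod (e k))" unfolding l by simp
  finally have l': "l * cnj (e k) = - of_real (cmod (e k))" .
  define s where "s = (!) [k, 0]"
  define x where "x = (!) [1, l]"
  have "0 \<le> Re (\<Sum>i<2. \<Sum>j<2. x i * cnj (x j) * e (s i - s j))"
    using e unfolding positive_definite_def by blast
  also have "(\<Sum>i<2. \<Sum>j<2. x i * cnj (x j) * e (s i - s j))
      = e 0 + cnj l * e k + l * cnj (e k) + (l * cnj l) * e 0"
    using herm by (simp add: numeral_2_eq_2 lessThan_Suc x_def s_def)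
  finally show ?thesis
    by (simp add: l l')
qed

text \<open>If \<open>e k\<close> is the integral of \<open>z\<^sup>k\<close> against a positive measure on the unit circle, then \<open>F k\<close>
  is the integral of \<open>z\<^sup>k \<bar>1 - r z\<bar>\<^sup>2\<close>, so \<open>\<bar>F k\<bar> \<le> F 0\<close>. In terms of \<open>e\<close> the form is tested
  on \<open>z\<^sup>k (1 - r z) + l (1 - r z)\<close>, that is, on the points
  \<open>k\<close>, \<open>k + 1\<close>, \<open>0\<close>, \<open>1\<close>, some of which may coincide.\<close>
lemma positive_definite_filtered_norm_le:
  fixes r :: real and e :: "int \<Rightarrow> complex"
  assumes e: "positive_definite e"
  defines "F \<equiv> \<lambda>k. (1 + r\<^sup>2) * e k - r * e (k + 1) - r * e (k - 1)"
  shows "cmod (F k) \<le> Re (F 0)"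
proof -
  obtain l where l: "l * cnj l = 1" "cnj l * F k = - of_real (cmod (F k))"
    by (rule unimodular_direction)
  have herm: "e (- k) = cnj (e k)" for k
    using e by (simp add: positive_definite_def)
  have Fherm: "F (- k) = cnj (F k)"
  proof -
    have "e (- k + 1) = cnj (e (k - 1))" "e (- k - 1) = cnj (e (k + 1))"
      using herm[of "k - 1"] herm[of "k + 1"] by simp_all
    then show ?thesis
      unfolding F_def by (simp add: herm)
  qed
  have "l * cnj (F k) = cnj (cnj l * F k)" by simp
  also have "\<dots> = - of_real (cmod (F k))" unfolding l by simp
  finally have l': "l * F (- k) = - of_real (cmod (F k))" unfolding Fherm .
  define s where "s = (!) [k, k + 1, 0, 1]"
  define x where "x = (!) [1, - of_real r, l, - of_real r * l]"
  have "0 \<le> Re (\<Sum>i<4. \<Sum>j<4. x i * cnj (x j) * e (s i - s j))"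
    using e unfolding positive_definite_def by blast
  also have "(\<Sum>i<4. \<Sum>j<4. x i * cnj (x j) * e (s i - s j))
      = F 0 + cnj l * F k + l * F (- k) + (l * cnj l) * F 0"
  proof -
    have "(4::nat) = Suc (Suc (Suc (Suc 0)))" by simp
    moreover have "e (- 1 - k) = e (- k - 1)"
      by (rule arg_cong[of _ _ e]) simp
    ultimately show ?thesis
      by (simp only: lessThan_Suc) (simp add: x_def s_def F_def algebra_simps power2_eq_square)
  qed
  finally show ?thesis
    by (simp add: l l')
qed

text \<open>This is the Cauchy-Schwarz inequality for the pairing of \<open>z - 1\<close> with a character: for a
  probability measure, the squared modulus of the integral of \<open>z\<^sup>k (z - 1)\<close> is at most the integral of
  \<open>\<bar>z - 1\<bar>\<^sup>2\<close>. The weight \<open>- l\<close> at the point \<open>0\<close> minimises the form.\<close>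
lemma positive_definite_diff_norm_sq_le:
  assumes e: "positive_definite e" and e0: "e 0 = 1"
  shows "(cmod (e (k + 1) - e k))\<^sup>2 \<le> 2 - 2 * Re (e 1)"
proof -
  have herm: "e (- k) = cnj (e k)" for k
    using e by (simp add: positive_definite_def)
  define l where "l = e (k + 1) - e k"
  define s where "s = (!) [k + 1, k, 0]"
  define x where "x = (!) [1, - 1, - l]"
  have "0 \<le> Re (\<Sum>i<3. \<Sum>j<3. x i * cnj (x j) * e (s i - s j))"
    using e unfolding positive_definite_def by blast
  also have "(\<Sum>i<3. \<Sum>j<3. x i * cnj (x j) * e (s i - s j))
      = 2 - e 1 - cnj (e 1) - l * cnj l"
  proof -
    have "(3::nat) = Suc (Suc (Suc 0))" by simp
    moreover have "e (- 1 - k) = cnj (e (k + 1))"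
      using herm[of "k + 1"] by (simp add: algebra_simps)
    ultimately show ?thesis
      using herm[of 1] herm[of k]
      by (simp only: lessThan_Suc) (simp add: x_def s_def l_def e0 algebra_simps)
  qed
  also have "l * cnj l = of_real ((cmod l)\<^sup>2)"
    by (simp only: complex_norm_square)
  finally show ?thesis
    by (simp add: l_def)
qed

text \<open>In the integral notation, put \<open>G k = \<integral> z\<^sup>k (1 - r z)\<close>. Since
  \<open>1 - r z = \<bar>1 - r z\<bar>\<^sup>2 + r w (1 - r z)\<close> on the unit circle, where \<open>w\<close> is the conjugate of
  \<open>z\<close>, the recursion \<open>G k = F k + r G (k - 1)\<close> holds, and each \<open>F k\<close> is bounded by
  \<open>F 0 = 1 + r\<^sup>2 - 2 r q\<close>. Unrolling it down to \<open>G (-1) = q - r\<close> produces the geometric sum.\<close>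
lemma positive_definite_consecutive_bound:
  fixes q r :: real and e :: "int \<Rightarrow> complex"
  assumes e: "positive_definite e" and e0: "e 0 = 1" and e1: "e 1 = of_real q"
    and r: "0 \<le> r" "r \<le> 1"
  shows "cmod (e (int n - 1) - of_real r * e (int n))
    \<le> (\<Sum>j<n. r ^ j) * (1 + r\<^sup>2 - 2 * r * q) + r ^ n * (1 - r * q)"
proof (induction n)
  case 0
  have em1: "e (- 1) = of_real q"
    using e e1 by (simp add: positive_definite_def)
  have "cmod (e 1) \<le> 1"
    using positive_definite_norm_le[OF e, of 1] e0 by simp
  then have q: "\<bar>q\<bar> \<le> 1"
    by (simp add: e1)
  \<comment> \<open>The products are \<open>(1 - r q) + (q - r)\<close> and \<open>(1 - r q) - (q - r)\<close>.\<close>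
  have "0 \<le> (1 - r) * (1 + q)" "0 \<le> (1 + r) * (1 - q)"
    using q r by simp_all
  then have "\<bar>q - r\<bar> \<le> 1 - r * q"
    by (simp add: algebra_simps abs_le_iff)
  then show ?case
    by (simp add: em1 e0 flip: of_real_diff)
next
  case (Suc n)
  define G where "G k = e k - of_real r * e (k + 1)" for k
  define F where "F k = (1 + r\<^sup>2) * e k - r * e (k + 1) - r * e (k - 1)" for k
  have "e (- 1) = of_real q"
    using e e1 by (simp add: positive_definite_def)
  then have F0: "Re (F 0) = 1 + r\<^sup>2 - 2 * r * q"
    by (simp add: F_def e0 e1 power2_eq_square)
  have "cmod (F (int n)) \<le> Re (F 0)"
    unfolding F_def by (rule positive_definite_filtered_norm_le[OF e])
  moreover have "G (int n) = F (int n) + of_real r * G (int n - 1)"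
    by (simp add: G_def F_def algebra_simps power2_eq_square)
  ultimately have "cmod (G (int n)) \<le> (1 + r\<^sup>2 - 2 * r * q) + r * cmod (G (int n - 1))"
    using norm_triangle_ineq[of "F (int n)" "of_real r * G (int n - 1)"] r
    by (simp add: F0 norm_mult)
  also have "r * cmod (G (int n - 1))
      \<le> r * ((\<Sum>j<n. r ^ j) * (1 + r\<^sup>2 - 2 * r * q) + r ^ n * (1 - r * q))"
    using Suc.IH r by (intro mult_left_mono) (simp_all add: G_def)
  also have "(1 + r\<^sup>2 - 2 * r * q) + r * ((\<Sum>j<n. r ^ j) * (1 + r\<^sup>2 - 2 * r * q) + r ^ n * (1 - r * q))
      = (1 + r * (\<Sum>j<n. r ^ j)) * (1 + r\<^sup>2 - 2 * r * q) + r ^ Suc n * (1 - r * q)"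
    by (simp add: algebra_simps)
  also have "1 + r * (\<Sum>j<n. r ^ j) = (\<Sum>j<Suc n. r ^ j)"
    by (subst sum.lessThan_Suc_shift) (simp add: sum_distrib_left)
  finally show ?case
    by (simp add: G_def add.commute)
qed

section \<open>The closed form of the bound\<close>

text \<open>The stated bound depends, up to the factor \<open>2 ^ N / \<sigma>\<close>, only on the ratio \<open>\<sigma> / \<mu>\<close> and on
  \<open>q = (p / 2) ^ N\<close>; in these terms it is exactly the right-hand side of the preceding estimate for
  consecutive members of a positive definite sequence.\<close>
lemma bound_in_ratio_form:
  fixes \<sigma> \<mu> p q :: real
  assumes "0 < \<sigma>" "\<sigma> < \<mu>" "N \<ge> 1" "p ^ N = 2 ^ N * q" "q \<le> 1"
  shows "2 * (\<sigma> ^ n - \<mu> ^ n) * (2 ^ (N - 1) * \<sigma>\<^sup>2 + 2 ^ (N - 1) * \<mu>\<^sup>2 - \<sigma> * \<mu> * p ^ N)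
           / ((\<sigma> - \<mu>) * \<sigma> * \<mu> ^ (n + 1)) + \<sigma> ^ n * \<bar>2 ^ N * \<mu> - \<sigma> * p ^ N\<bar> / (\<sigma> * \<mu> ^ (n + 1))
       = 2 ^ N / \<sigma> * ((\<Sum>j<n. (\<sigma> / \<mu>) ^ j) * (1 + (\<sigma> / \<mu>)\<^sup>2 - 2 * (\<sigma> / \<mu>) * q)
           + (\<sigma> / \<mu>) ^ n * (1 - \<sigma> / \<mu> * q))" (is "?A + ?B = ?C")
proof -
  define r where "r = \<sigma> / \<mu>"
  define T :: real where "T = 2 ^ (N - 1)"
  have T: "2 ^ N = 2 * T"
    using assms(3) by (simp add: T_def flip: power_Suc)
  have r: "0 < r" "r < 1" and \<sigma>: "\<sigma> = r * \<mu>"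
    using assms by (simp_all add: r_def)
  have \<mu>: "\<mu> > 0" using assms by simp
  have "r * q \<le> 1"
    using r assms(5) by (metis less_eq_real_def mult_left_le order_trans)
  then have "\<bar>1 - r * q\<bar> = 1 - r * q" by simp
  have gs: "(\<Sum>j<n. r ^ j) = (r ^ n - 1) / (r - 1)"
    using r by (intro geometric_sum) simp
  have "2 * (\<sigma> ^ n - \<mu> ^ n) * (T * \<sigma>\<^sup>2 + T * \<mu>\<^sup>2 - \<sigma> * \<mu> * p ^ N)
      = (\<mu> ^ (n + 2)) * (2 * T * ((r ^ n - 1) * (1 + r\<^sup>2 - 2 * r * q)))"
    unfolding assms(4) T \<sigma> by (simp add: power_mult_distrib algebra_simps power2_eq_square)
  moreover have "(\<sigma> - \<mu>) * \<sigma> * \<mu> ^ (n + 1) = \<mu> ^ (n + 2) * ((r - 1) * \<sigma>)"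
    unfolding \<sigma> by (simp add: algebra_simps)
  ultimately have "?A = \<mu> ^ (n + 2) * (2 * T * ((r ^ n - 1) * (1 + r\<^sup>2 - 2 * r * q)))
      / (\<mu> ^ (n + 2) * ((r - 1) * \<sigma>))"
    unfolding T_def[symmetric] by (simp only:)
  also have "\<dots> = 2 * T * ((r ^ n - 1) * (1 + r\<^sup>2 - 2 * r * q)) / ((r - 1) * \<sigma>)"
    using \<mu> by (intro mult_divide_mult_cancel_left) simp
  finally have A: "?A = 2 * T / \<sigma> * ((\<Sum>j<n. r ^ j) * (1 + r\<^sup>2 - 2 * r * q))"
    unfolding gs by simp
  have "2 ^ N * \<mu> - \<sigma> * p ^ N = 2 * T * \<mu> * (1 - r * q)"
    unfolding assms(4) T \<sigma> by (simp add: algebra_simps)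
  then have "\<bar>2 ^ N * \<mu> - \<sigma> * p ^ N\<bar> = 2 * T * \<mu> * (1 - r * q)"
    using \<mu> \<open>r * q \<le> 1\<close> by (simp add: abs_mult T_def)
  moreover have "\<sigma> ^ n = r ^ n * \<mu> ^ n"
    unfolding \<sigma> by (simp add: power_mult_distrib)
  ultimately have "?B = 2 * T / \<sigma> * (r ^ n * (1 - r * q))"
    using \<mu> by simp
  with A show ?thesis
    unfolding T r_def by (simp add: distrib_left)
qed

section \<open>Coefficients of functions in the class\<close>

lemma weighted_mean_sums:
  fixes f :: "complex \<Rightarrow> complex"
  assumes f: "\<And>z. norm z < 1 \<Longrightarrow> (\<lambda>k. A k * z ^ k) sums f z"
    and A: "A 0 = 0" "A 1 = 1" and z: "norm z < 1"
  shows "(\<lambda>k. of_real (1 + (1 - \<beta>) * real k) * A (Suc k) * z ^ k) sums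
           (of_real \<beta> * quot_z f z + of_real (1 - \<beta>) * deriv f z)"
proof -
  have "(\<lambda>k. A (Suc k) * z ^ k) sums quot_z f z"
  proof (cases "z = 0")
    case True
    then show ?thesis
      using A powser_sums_zero[of "\<lambda>k. A (Suc k)"] by (simp add: quot_z_def)
  next
    case False
    have "(\<lambda>k. A (Suc k) * z ^ Suc k) sums f z"
      using f[OF z] A by (subst sums_Suc_iff) simp
    from sums_divide[OF this, of z] show ?thesis
      using False by (simp add: quot_z_def mult_ac)
  qed
  moreover have "(\<lambda>k. diffs A k * z ^ k) sums deriv f z"
    using power_series_deriv_sums[OF f z] by simp
  ultimately have "(\<lambda>k. of_real \<beta> * (A (Suc k) * z ^ k) + of_real (1 - \<beta>) * (diffs A k * z ^ k)) sums
      (of_real \<beta> * quot_z f z + of_real (1 - \<beta>) * deriv f z)"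
    by (intro sums_add sums_mult)
  then show ?thesis
    by (simp add: diffs_def algebra_simps)
qed

text \<open>A normalized series says nothing about \<open>a 0\<close> and \<open>a 1\<close>; \<open>A\<close> replaces them by the
  coefficients \<open>0\<close> and \<open>1\<close> that \<open>f\<close> really has.\<close>
lemma normalized_series_sums_iff:
  assumes "A 0 = 0" "A 1 = 1" "\<And>k. A (k + 2) = a (k + 2)"
  shows "normalized_series f a \<longleftrightarrow> (\<forall>z \<in> ball 0 1. (\<lambda>k. A k * z ^ k) sums f z)"
proof -
  have "(\<lambda>k. a (k + 2) * z ^ (k + 2)) sums (f z - z) \<longleftrightarrow> (\<lambda>k. A k * z ^ k) sums f z" for z
    using sums_iff_shift[of "\<lambda>k. A k * z ^ k" 2 "f z - z"] assms by (simp add: numeral_2_eq_2)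
  then show ?thesis
    by (simp add: normalized_series_def)
qed

text \<open>The function \<open>g z = \<beta> f(z)/z + (1 - \<beta>) f'(z)\<close> has positive real part, value \<open>1\<close> at
  \<open>0\<close>, and coefficients \<open>c\<^sub>k = (1 + (1 - \<beta>) k) a (k + 1)\<close>. So \<open>(c\<^sub>k / 2)\<^sup>N\<close> is positive
  definite, and the constraint on \<open>a\<^sub>2\<close> says that \<open>c\<^sub>1 = p\<close>.\<close>
lemma class_A_beta_p_positive_definite:
  assumes f: "f \<in> class_A_beta_p \<beta> p" and a: "normalized_series f a" and \<beta>: "\<beta> \<le> 1"
  obtains e where "positive_definite e" "e 0 = 1" "e 1 = of_real ((p / 2) ^ N)"
    "\<And>k. k \<ge> 1 \<Longrightarrow> a (k + 1) ^ N = of_real (2 ^ N / (1 + (1 - \<beta>) * real k) ^ N) * e (int k)"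
proof -
  define A where "A k = (if k = 0 then 0 else if k = 1 then 1 else a k)" for k
  have fs: "(\<lambda>k. A k * z ^ k) sums f z" if "norm z < 1" for z
    using a that normalized_series_sums_iff[of A a f] by (auto simp: A_def)
  define g where "g z = of_real \<beta> * quot_z f z + of_real (1 - \<beta>) * deriv f z" for z
  define c where "c k = of_real (1 + (1 - \<beta>) * real k) * A (Suc k)" for k
  have gs: "(\<lambda>k. c k * z ^ k) sums g z" if "norm z < 1" for z
    unfolding c_def g_def using that by (intro weighted_mean_sums fs) (simp_all add: A_def)
  have hol: "g holomorphic_on ball 0 1"
    by (rule power_series_holomorphic[where a = c]) (use gs in auto)
  have ck: "(deriv ^^ k) g 0 / fact k = c k" for k
    using power_series_higher_deriv_0[OF gs, where k = k] by simp
  have g0: "g 0 = 1"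
    using ck[of 0] by (simp add: c_def A_def)
  have pos: "Re (g z) > 0" if "z \<in> ball 0 1" for z
    using f that by (simp add: class_A_beta_p_def class_A_beta_def g_def)
  have "(deriv ^^ 2) f 0 = fact 2 * A 2"
    by (rule power_series_higher_deriv_0[OF fs])
  then have c1: "c 1 = of_real p"
    using f by (simp add: class_A_beta_p_def c_def numeral_2_eq_2)
  define e where "e k = half_coeffs c k ^ N" for k
  show ?thesis
  proof
    show "positive_definite e"
      using positive_definite_half_coeffs_power[OF hol g0 pos, of N] unfolding ck e_def .
    show "e 0 = 1" "e 1 = of_real ((p / 2) ^ N)"
      using c1 by (simp_all add: e_def half_coeffs_def)
    fix k :: nat
    assume k: "k \<ge> 1"
    have "1 + (1 - \<beta>) * real k > 0"
      using \<beta> by (simp add: add_pos_nonneg)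
    then have "complex_of_real (1 + (1 - \<beta>) * real k) \<noteq> 0"
      by (metis of_real_eq_0_iff less_irrefl)
    then have "a (k + 1) = of_real (2 / (1 + (1 - \<beta>) * real k)) * half_coeffs c (int k)"
      using k by (simp add: half_coeffs_def c_def A_def del: of_real_add of_real_mult)
    then show "a (k + 1) ^ N = of_real (2 ^ N / (1 + (1 - \<beta>) * real k) ^ N) * e (int k)"
      by (simp add: e_def power_mult_distrib power_divide)
  qed
qed

section \<open>Extremal functions\<close>

lemma Re_half_plane_map_pos:
  assumes "norm w < 1"
  shows "Re (2 / (1 - w) - 1) > 0"
proof -
  have "w \<noteq> 1" using assms by auto
  have "Re ((1 + w) / (1 - w)) = (1 - (norm w)\<^sup>2) / (norm (1 - w))\<^sup>2"
    by (simp add: Re_divide cmod_power2) (simp add: algebra_simps power2_eq_square)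
  moreover have "(norm w)\<^sup>2 < 1"
    using assms by (simp add: power_less_one_iff abs_square_less_1)
  moreover have "2 / (1 - w) - 1 = (1 + w) / (1 - w)"
    using \<open>w \<noteq> 1\<close> by (simp add: field_simps)
  ultimately show ?thesis
    using \<open>w \<noteq> 1\<close> by simp
qed

text \<open>The measure concentrated at the single point \<open>\<epsilon>\<close> gives
  \<open>g z = (1 + \<epsilon> z) / (1 - \<epsilon> z) = 1 + \<Sum> 2 \<epsilon>\<^sup>k z\<^sup>k\<close>; solving for \<open>f\<close> divides the
  coefficients by \<open>1 + (1 - \<beta>) k\<close>.\<close>
lemma extremal_function_exists:
  fixes \<epsilon> \<beta> :: real
  assumes \<epsilon>: "\<bar>\<epsilon>\<bar> = 1" and \<beta>: "\<beta> \<le> 1"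
  obtains f a where "f \<in> class_A_beta_p \<beta> (2 * \<epsilon>)" "normalized_series f a"
    "\<And>k. k \<ge> 1 \<Longrightarrow> a (k + 1) = of_real (2 * \<epsilon> ^ k / (1 + (1 - \<beta>) * real k))"
proof -
  define a where "a k = complex_of_real (2 * \<epsilon> ^ (k - 1) / (1 + (1 - \<beta>) * real (k - 1)))" for k
  define A where "A k = (if k = 0 then 0 else if k = 1 then 1 else a k)" for k
  define f where "f z = (\<Sum>k. A k * z ^ k)" for z
  have den: "1 + (1 - \<beta>) * real k \<ge> 1" for k
    using \<beta> by simp
  have \<epsilon>k: "\<bar>\<epsilon> ^ k\<bar> = 1" for k
    using \<epsilon> by (simp add: power_abs)
  have A_le: "norm (A k) \<le> 2" for k
  proof -
    have "norm (a k) \<le> 2"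
      using den[of "k - 1"] \<epsilon>k[of "k - 1"]
      unfolding a_def norm_of_real abs_divide abs_mult by (simp add: divide_le_eq)
    then show ?thesis
      by (simp add: A_def)
  qed
  have fs: "(\<lambda>k. A k * z ^ k) sums f z" if z: "norm z < 1" for z
  proof -
    have "summable (\<lambda>k. 2 * norm z ^ k)"
      using z by (intro summable_mult summable_geometric) simp
    then have "summable (\<lambda>k. A k * z ^ k)"
      by (rule summable_comparison_test')
         (auto simp: norm_mult norm_power intro!: mult_right_mono A_le)
    then show ?thesis
      by (simp add: f_def summable_sums)
  qed
  have ns: "normalized_series f a"
    using fs by (subst normalized_series_sums_iff[of A]) (auto simp: A_def)
  define g where "g z = of_real \<beta> * quot_z f z + of_real (1 - \<beta>) * deriv f z" for z
  have g: "g z = 2 / (1 - of_real \<epsilon> * z) - 1" if z: "norm z < 1" for z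
  proof -
    have c: "of_real (1 + (1 - \<beta>) * real k) * A (Suc k) * z ^ k
        = 2 * (of_real \<epsilon> * z) ^ k - (if k = 0 then 1 else 0)" for k
    proof (cases "k = 0")
      case False
      have "complex_of_real (1 + (1 - \<beta>) * real k) \<noteq> 0"
        using den[of k] by (metis of_real_eq_0_iff not_one_le_zero)
      then show ?thesis
        using False by (simp add: A_def a_def power_mult_distrib del: of_real_add of_real_mult)
          (simp add: mult_ac)
    qed (simp add: A_def)
    have "norm (of_real \<epsilon> * z) < 1"
      using z \<epsilon> by (simp add: norm_mult)
    then have "(\<lambda>k. 2 * (of_real \<epsilon> * z) ^ k - (if k = 0 then 1 else 0)) sums (2 * (1 / (1 - of_real \<epsilon> * z)) - 1)"
      by (intro sums_diff sums_mult geometric_sums sums_single[of 0 "\<lambda>_. 1"])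
    moreover have "(\<lambda>k. 2 * (of_real \<epsilon> * z) ^ k - (if k = 0 then 1 else 0)) sums g z"
      using weighted_mean_sums[OF fs _ _ z, of \<beta>] unfolding c g_def by (simp add: A_def)
    ultimately show ?thesis
      using sums_unique2 by fastforce
  qed
  have "f \<in> class_A_beta \<beta>"
  proof -
    have "f holomorphic_on ball 0 1"
      by (rule power_series_holomorphic[where a = A]) (use fs in auto)
    moreover have "Re (g z) > 0" if "z \<in> ball 0 1" for z
      using that \<epsilon> Re_half_plane_map_pos[of "of_real \<epsilon> * z"] g[of z] by (simp add: norm_mult)
    ultimately show ?thesis
      using ns by (auto simp: class_A_beta_def class_A_def g_def)
  qed
  moreover have "of_real (2 - \<beta>) * ((deriv ^^ 2) f 0 / 2) = complex_of_real (2 * \<epsilon>)"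
  proof -
    have "(deriv ^^ 2) f 0 = fact 2 * A 2"
      by (rule power_series_higher_deriv_0[OF fs])
    also have "A 2 = of_real (2 * \<epsilon> / (2 - \<beta>))"
      by (simp add: A_def a_def)
    finally have "(deriv ^^ 2) f 0 / 2 = complex_of_real (2 * \<epsilon> / (2 - \<beta>))"
      unfolding fact_2 by (metis nonzero_mult_div_cancel_left zero_neq_numeral)
    then have "of_real (2 - \<beta>) * ((deriv ^^ 2) f 0 / 2) = complex_of_real ((2 - \<beta>) * (2 * \<epsilon> / (2 - \<beta>)))"
      by (simp only: of_real_mult)
    also have "(2 - \<beta>) * (2 * \<epsilon> / (2 - \<beta>)) = 2 * \<epsilon>"
      using \<beta> by simp
    finally show ?thesis .
  qed
  ultimately have "f \<in> class_A_beta_p \<beta> (2 * \<epsilon>)"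
    by (simp add: class_A_beta_p_def)
  then show ?thesis
    using ns by (rule that) (simp add: a_def)
qed

section \<open>The coefficient difference theorem\<close>

theorem theorem4p1:
  fixes \<beta> p \<sigma> \<mu> B :: real and N n :: nat
  assumes "0 \<le> \<beta>" and "\<beta> \<le> 1"
    and "-2 \<le> p" and "p \<le> 2"
    and "N \<ge> 1" and "n \<ge> 2"
    and "\<sigma> = (real n - (real n - 1) * \<beta>) ^ N"
    and "\<mu> = (real n + 1 - real n * \<beta>) ^ N"
    and "B = (if \<beta> < 1
          then 2 * (\<sigma> ^ n - \<mu> ^ n) * (2 ^ (N - 1) * \<sigma>\<^sup>2 + 2 ^ (N - 1) * \<mu>\<^sup>2 - \<sigma> * \<mu> * p ^ N)
                 / ((\<sigma> - \<mu>) * \<sigma> * \<mu> ^ (n + 1))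
               + \<sigma> ^ n * \<bar>2 ^ N * \<mu> - \<sigma> * p ^ N\<bar> / (\<sigma> * \<mu> ^ (n + 1))
          else 2 ^ N * sqrt (2 - 2 powi (1 - int N) * p ^ N) / \<sigma>)"
  shows "(\<forall>f a. f \<in> class_A_beta_p \<beta> p \<longrightarrow> normalized_series f a \<longrightarrow>
            cmod (a (n + 1) ^ N - a n ^ N) \<le> B)
       \<and> (\<beta> < 1 \<longrightarrow> p = 2 \<longrightarrow>
            (\<exists>f a. f \<in> class_A_beta_p \<beta> p \<and> normalized_series f a \<and>
              cmod (a (n + 1) ^ N - a n ^ N) = B))
       \<and> (\<beta> = 1 \<longrightarrow> odd N \<longrightarrow> p = -2 \<longrightarrow>
            (\<exists>f a. f \<in> class_A_beta_p \<beta> p \<and> normalized_series f a \<and>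
              cmod (a (n + 1) ^ N - a n ^ N) = B))"
proof -
  define q where "q = (p / 2) ^ N"
  define r where "r = \<sigma> / \<mu>"
  have q: "p ^ N = 2 ^ N * q"
    by (simp add: q_def power_divide)
  have "\<bar>q\<bar> \<le> 1"
    unfolding q_def power_abs using assms(3,4) by (intro power_le_one) auto
  have \<sigma>: "\<sigma> = (1 + (1 - \<beta>) * real (n - 1)) ^ N"
    unfolding assms(7) using assms(6) by (simp add: of_nat_diff algebra_simps)
  have \<mu>: "\<mu> = (1 + (1 - \<beta>) * real n) ^ N"
    unfolding assms(8) by (simp add: algebra_simps)
  have pos: "\<sigma> > 0" "\<mu> > 0"
    unfolding \<sigma> \<mu> using assms(2) by (simp_all add: add_pos_nonneg)
  have less: "\<sigma> < \<mu>" if "\<beta> < 1"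
    unfolding \<sigma> \<mu> using assms(5,6) that
    by (intro power_strict_mono) (simp_all add: add_nonneg_nonneg)
  have B_lt: "B = 2 ^ N / \<sigma> * ((\<Sum>j<n. r ^ j) * (1 + r\<^sup>2 - 2 * r * q) + r ^ n * (1 - r * q))" if "\<beta> < 1"
    using bound_in_ratio_form[OF pos(1) less[OF that] assms(5) q] \<open>\<bar>q\<bar> \<le> 1\<close> that
    unfolding assms(9) r_def by simp
  have B_eq: "B = 2 ^ N * sqrt (2 - 2 * q)" "\<sigma> = 1" "\<mu> = 1" if "\<beta> = 1"
  proof -
    show "\<sigma> = 1" "\<mu> = 1"
      using that by (simp_all add: \<sigma> \<mu>)
    have "2 powi (1 - int N) * 2 ^ N = (2 :: real)"
      by (simp add: power_int_diff)
    then have "2 powi (1 - int N) * p ^ N = 2 * q"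
      by (simp add: q)
    then show "B = 2 ^ N * sqrt (2 - 2 * q)"
      using that \<open>\<sigma> = 1\<close> by (simp add: assms(9))
  qed

  have bound: "cmod (a (n + 1) ^ N - a n ^ N) \<le> B"
    if f: "f \<in> class_A_beta_p \<beta> p" and a: "normalized_series f a" for f a
  proof -
    obtain e where e: "positive_definite e" "e 0 = 1" "e 1 = of_real q"
      and ae: "\<And>k. k \<ge> 1 \<Longrightarrow> a (k + 1) ^ N = of_real (2 ^ N / (1 + (1 - \<beta>) * real k) ^ N) * e (int k)"
      using class_A_beta_p_positive_definite[OF f a assms(2), of N] unfolding q_def by blast
    have an1: "a (n + 1) ^ N = of_real (2 ^ N / \<mu>) * e (int n)"
      using ae[of n] assms(6) by (simp add: \<mu>)
    have an: "a n ^ N = of_real (2 ^ N / \<sigma>) * e (int n - 1)"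
      using ae[of "n - 1"] assms(6) by (simp add: \<sigma> of_nat_diff)
    show ?thesis
    proof (cases "\<beta> < 1")
      case True
      have "a (n + 1) ^ N - a n ^ N = - of_real (2 ^ N / \<sigma>) * (e (int n - 1) - of_real r * e (int n))"
        unfolding an an1 r_def using pos by (simp add: field_simps)
      then have "cmod (a (n + 1) ^ N - a n ^ N) = 2 ^ N / \<sigma> * cmod (e (int n - 1) - of_real r * e (int n))"
        using pos by (simp add: norm_mult norm_divide norm_power)
      also have "\<dots> \<le> 2 ^ N / \<sigma> * ((\<Sum>j<n. r ^ j) * (1 + r\<^sup>2 - 2 * r * q) + r ^ n * (1 - r * q))"
        using pos less[OF True]
        by (intro mult_left_mono positive_definite_consecutive_bound e) (simp_all add: r_def)
      finally show ?thesis
        using B_lt[OF True] by simp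
    next
      case False
      with assms(2) have "\<beta> = 1" by simp
      note B = B_eq[OF this]
      have "(cmod (e (int n) - e (int n - 1)))\<^sup>2 \<le> 2 - 2 * q"
        using positive_definite_diff_norm_sq_le[OF e(1,2), of "int n - 1"] e(3) by simp
      then have "cmod (e (int n) - e (int n - 1)) \<le> sqrt (2 - 2 * q)"
        by (rule real_le_rsqrt)
      moreover have "a (n + 1) ^ N - a n ^ N = of_real (2 ^ N) * (e (int n) - e (int n - 1))"
        unfolding an an1 using B by (simp add: algebra_simps)
      then have "cmod (a (n + 1) ^ N - a n ^ N) = 2 ^ N * cmod (e (int n) - e (int n - 1))"
        by (simp add: norm_mult norm_power)
      ultimately show ?thesis
        by (simp add: B)
    qed
  qed

  have extremal: "\<exists>f a. f \<in> class_A_beta_p \<beta> p \<and> normalized_series f a \<and>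
      cmod (a (n + 1) ^ N - a n ^ N) = \<bar>(2 * \<epsilon> ^ n) ^ N / \<mu> - (2 * \<epsilon> ^ (n - 1)) ^ N / \<sigma>\<bar>"
    if \<epsilon>: "\<bar>\<epsilon>\<bar> = 1" "p = 2 * \<epsilon>" for \<epsilon>
  proof -
    obtain f a where f: "f \<in> class_A_beta_p \<beta> (2 * \<epsilon>)" and a: "normalized_series f a"
      and ak: "\<And>k. k \<ge> 1 \<Longrightarrow> a (k + 1) = of_real (2 * \<epsilon> ^ k / (1 + (1 - \<beta>) * real k))"
      using extremal_function_exists[OF \<epsilon>(1) assms(2)] by blast
    have "a (n + 1) = of_real (2 * \<epsilon> ^ n / (1 + (1 - \<beta>) * real n))"
      using assms(6) by (intro ak) simp
    then have "a (n + 1) ^ N = of_real ((2 * \<epsilon> ^ n) ^ N / \<mu>)"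
      unfolding \<mu> by (simp only: power_divide flip: of_real_power)
    moreover have "a (n - 1 + 1) = of_real (2 * \<epsilon> ^ (n - 1) / (1 + (1 - \<beta>) * real (n - 1)))"
      using assms(6) by (intro ak) simp
    then have "a (n - 1 + 1) ^ N = of_real ((2 * \<epsilon> ^ (n - 1)) ^ N / \<sigma>)"
      unfolding \<sigma> by (simp only: power_divide flip: of_real_power)
    then have "a n ^ N = of_real ((2 * \<epsilon> ^ (n - 1)) ^ N / \<sigma>)"
      using assms(6) by simp
    ultimately have "a (n + 1) ^ N - a n ^ N
        = of_real ((2 * \<epsilon> ^ n) ^ N / \<mu> - (2 * \<epsilon> ^ (n - 1)) ^ N / \<sigma>)"
      by (simp only: of_real_diff)
    then have "cmod (a (n + 1) ^ N - a n ^ N) = \<bar>(2 * \<epsilon> ^ n) ^ N / \<mu> - (2 * \<epsilon> ^ (n - 1)) ^ N / \<sigma>\<bar>"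
      by (simp only: norm_of_real)
    then show ?thesis
      using f a \<epsilon>(2) by blast
  qed

  \<comment> \<open>For \<open>q = 1\<close> the factor \<open>1 + r\<^sup>2 - 2 r q\<close> is \<open>(1 - r)\<^sup>2\<close>, so the geometric sum telescopes and
    the bound collapses to \<open>2 ^ N / \<sigma> - 2 ^ N / \<mu>\<close>.\<close>
  have "\<exists>f a. f \<in> class_A_beta_p \<beta> p \<and> normalized_series f a \<and> cmod (a (n + 1) ^ N - a n ^ N) = B"
    if "\<beta> < 1" "p = 2"
  proof -
    have "q = 1" using that by (simp add: q_def)
    have r: "r < 1" using less[OF that(1)] pos by (simp add: r_def)
    then have "(\<Sum>j<n. r ^ j) * (1 - r) = 1 - r ^ n"
      by (simp add: one_diff_power_eq mult.commute)
    then have "(\<Sum>j<n. r ^ j) * (1 - r) * (1 - r) = (1 - r ^ n) * (1 - r)"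
      by simp
    then have "(\<Sum>j<n. r ^ j) * (1 + r\<^sup>2 - 2 * r * 1) = (1 - r ^ n) * (1 - r)"
      by (simp add: algebra_simps power2_eq_square)
    then have "B = 2 ^ N / \<sigma> * (1 - r)"
      unfolding B_lt[OF that(1)] \<open>q = 1\<close> by (simp only:) (simp flip: distrib_right)
    also have "\<dots> = \<bar>2 ^ N / \<mu> - 2 ^ N / \<sigma>\<bar>"
    proof -
      have "2 ^ N / \<mu> - 2 ^ N / \<sigma> = - (2 ^ N / \<sigma> * (1 - r))"
        using pos by (simp add: r_def field_simps)
      then show ?thesis
        using r pos by (simp add: abs_mult)
    qed
    finally show ?thesis
      using extremal[of 1] that by simp
  qed
  \<comment> \<open>For odd \<open>N\<close> consecutive terms \<open>(2 (- 1)\<^sup>k)\<^sup>N\<close> have opposite signs, so their moduli add up.\<close>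
  moreover have "\<exists>f a. f \<in> class_A_beta_p \<beta> p \<and> normalized_series f a \<and> cmod (a (n + 1) ^ N - a n ^ N) = B"
    if "\<beta> = 1" "odd N" "p = -2"
  proof -
    have "q = - 1" using that by (simp add: q_def)
    then have B: "B = 2 ^ N * 2"
      using B_eq[OF that(1)] by simp
    obtain l where l: "n = Suc l" using assms(6) by (cases n) auto
    have "(2 * (- 1) ^ n) ^ N / \<mu> - (2 * (- 1) ^ (n - 1)) ^ N / \<sigma> = - (2 ^ N * 2 * ((- 1) ^ l) ^ N)"
      using B_eq[OF that(1)] that(2) by (simp add: l power_mult_distrib)
    then have "\<bar>(2 * (- 1) ^ n) ^ N / \<mu> - (2 * (- 1) ^ (n - 1)) ^ N / \<sigma>\<bar> = B"
      by (simp add: B abs_mult power_abs)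
    then show ?thesis
      using extremal[of "- 1"] that by simp
  qed
  ultimately show ?thesis
    using bound by blast
qed

end
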